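(* Let $N\ge1$ and $m\ge 1$. On the standard plus-polarized radial PBW module (the span of all $Z_IB$ with $I$ an ordered subset of $\{1,\dots,N\}$ and $B\in\mathscr B^+$), $$\mathfrak s_i=\sum_{\ell=1}^N(m\delta_{i\ell}+\mathcal E^z_{\ell i})\,\mathfrak c_\ell^+ .$$ Consequently, for $m\ge2N$, $\mathfrak n_i^+=\mathfrak c_i^+$ on every standard radial exterior word. The order-preserving Hermitian conjugate gives the corresponding statement for $\mathfrak n_i^-$.
   Context: For $1\le k\le N$, $1\le a\le m$ let $z_{ka},\bar z_{ka}$ be independent commuting variables, and let $f_a,f_a^\dagger$ be a Witt basis of the complex Clifford algebra $\mathrm{Cl}_{2m}$: $\{f_a,f_b\}=\{f_a^\dagger,f_b^\dagger\}=0$, $\{f_a,f_b^\dagger\}=\delta_{ab}$. $\mathscr P^{\rm Cl}_{m,N}=\mathbb C[z_{ka},\bar z_{ka}]\otimes\mathrm{Cl}_{2m}$, $Z_k=\sum_az_{ka}f_a$, $Z_k^\dagger=\sum_a\bar z_{ka}f_a^\dagger$; $Z_I=Z_{i_1}\cdots Z_{i_r}$ for $I=(i_1<\dots<i_r)$. $\delta_a$ is the odd antiderivation (left contraction) of Clifford coefficients with $\delta_a(f_b)=\delta_{ab}$, $\delta_a(f_b^\dagger)=0$. $\mathfrak s_i=\sum_a\delta_a\partial_{z_{ia}}$, $\mathcal E^z_{ji}=\sum_az_{ja}\partial_{z_{ia}}$, $(\mathcal C_z)_{ij}=m\delta_{ij}+\mathcal E^z_{ji}$ (operator matrix on columns of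 polynomials, invertible on each homogeneous component for $m\ge2N$), and $\mathfrak n_i^+=\sum_\ell(\mathcal C_z^{-1})_{i\ell}\mathfrak s_\ell$. $\mathscr B^+\subset\mathscr P^{\rm Cl}_{m,N}$ is the subspace annihilated by all $\delta_a$ (it contains scalar polynomials and words in the daggered Witt symbols). The abstract Grassmann label contraction is $$\mathfrak c_i^+(Z_IB)=\sum_{t=1}^r(-1)^{t-1}\delta_{i,i_t}Z_{i_1}\cdots\widehat{Z_{i_t}}\cdots Z_{i_r}B,\qquad B\in\mathscr B^+ .$$ The order-preserving Hermitian conjugation is the antilinear algebra involution exchanging $z_{ka}\leftrightarrow\bar z_{ka}$ and $f_a\leftrightarrow f_a^\dagger$; the minus objects $\mathfrak n_i^-,\mathfrak c_i^-$ are the conjugates of the plus ones. *)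

theory Defs
  imports Complex_Main "HOL-Library.Cardinality" "HOL-Library.Poly_Mapping"
begin

section \<open>The complex Clifford algebra\<close>

text \<open>
  The complex Clifford algebra of \<open>\<complex>\<^sup>g\<close> with orthonormal basis \<open>e g\<close> indexed by a finite
  linearly ordered type, \<open>e g * e g = 1\<close> and \<open>e g * e h = - e h * e g\<close> for \<open>g \<noteq> h\<close>.  An element is given
  by its coefficients with respect to the ordered products \<open>e A\<close>, \<open>A\<close> a set of indices,
  and \<open>e A * e B = csign A B * e (A \<triangle> B)\<close>.  The algebra \<open>Cl\<^sub>2\<^sub>m\<close> is the case
  \<open>CARD('g) = 2 * m\<close>; over the complex numbers the choice \<open>e g * e g = 1\<close> (rather than \<open>-1\<close>) is
  immaterial.
\<close>

datatype 'g clifford = Clifford (coeff: "'g set \<Rightarrow> complex")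

lemma clifford_eqI: "(\<And>A. coeff x A = coeff y A) \<Longrightarrow> x = y"
  by (cases x; cases y) auto

definition csign :: "'g::linorder set \<Rightarrow> 'g set \<Rightarrow> complex" where
  "csign A B = (-1) ^ card {(a, b) \<in> A \<times> B. b < a}"

instantiation clifford :: ("{finite, linorder}") "{zero, one, plus, minus, uminus, times}"
begin

definition "0 = Clifford (\<lambda>_. 0)"
definition "1 = Clifford (\<lambda>A. if A = {} then 1 else 0)"
definition "x + y = Clifford (\<lambda>A. coeff x A + coeff y A)"
definition "x - y = Clifford (\<lambda>A. coeff x A - coeff y A)"
definition "- x = Clifford (\<lambda>A. - coeff x A)"
definition "x * y =
  Clifford (\<lambda>C. \<Sum>A\<in>UNIV. csign A (sym_diff A C) * coeff x A * coeff y (sym_diff A C))"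

instance ..

end

lemma coeff_simps [simp]:
  "coeff 0 A = 0"
  "coeff 1 A = (if A = {} then 1 else 0)"
  "coeff (x + y) A = coeff x A + coeff y A"
  "coeff (x - y) A = coeff x A - coeff y A"
  "coeff (- x) A = - coeff x A"
  by (simp_all add: zero_clifford_def one_clifford_def plus_clifford_def minus_clifford_def
      uminus_clifford_def)

lemma coeff_times:
  "coeff (x * y) C = (\<Sum>A\<in>UNIV. csign A (sym_diff A C) * coeff x A * coeff y (sym_diff A C))"
  by (simp add: times_clifford_def)

lemma csign_empty [simp]: "csign {} B = 1" "csign A {} = 1"
  by (simp_all add: csign_def)

lemma csign_prod:
  fixes A B :: "'g::{finite, linorder} set"
  shows "csign A B = (\<Prod>a\<in>A. \<Prod>b\<in>B. if b < a then -1 else 1)"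
proof -
  have "(\<Prod>a\<in>A. \<Prod>b\<in>B. if b < a then -1 else 1) =
      (\<Prod>p\<in>A \<times> B. if snd p < fst p then -1 else (1::complex))"
    by (simp add: prod.cartesian_product case_prod_unfold)
  also have "\<dots> = (\<Prod>p\<in>{p\<in>A \<times> B. snd p < fst p}. -1)"
    by (subst prod.inter_filter) auto
  also have "{p\<in>A \<times> B. snd p < fst p} = {(a, b) \<in> A \<times> B. b < a}"
    by auto
  finally show ?thesis
    by (simp add: csign_def)
qed

lemma prod_sym_diff_sign:
  fixes h :: "'a::finite \<Rightarrow> complex"
  assumes "\<And>x. h x * h x = 1"
  shows "prod h (sym_diff A B) = prod h A * prod h B"
proof -
  have *: "prod h A = prod h (A - B) * prod h (A \<inter> B)" for A B
    by (subst prod.union_disjoint [symmetric]) (auto simp: Un_Diff_Int intro!: prod.cong)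
  have sq: "prod h C * prod h C = 1" for C
    using assms by (simp flip: prod.distrib)
  have "prod h (sym_diff A B) = prod h (A - B) * prod h (B - A)"
    by (rule prod.union_disjoint) auto
  also have "\<dots> = prod h (A - B) * prod h (B - A) * (prod h (A \<inter> B) * prod h (A \<inter> B))"
    using sq by simp
  also have "\<dots> = prod h A * prod h B"
    using *[of A B] *[of B A] by (simp add: Int_commute mult_ac)
  finally show ?thesis .
qed

lemma csign_square: "csign A B * csign A B = 1"
  by (simp add: csign_def flip: power_add mult_2)

lemma csign_sym_diff_right:
  fixes A :: "'g::{finite, linorder} set"
  shows "csign A (sym_diff B C) = csign A B * csign A C"
  unfolding csign_prod
  by (simp only: flip: prod.distrib, rule prod.cong [OF refl], rule prod_sym_diff_sign) auto

lemma csign_sym_diff_left: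
  fixes A :: "'g::{finite, linorder} set"
  shows "csign (sym_diff A B) C = csign A C * csign B C"
  unfolding csign_prod
  by (rule prod_sym_diff_sign) (auto simp flip: prod.distrib intro!: prod.neutral)

lemma sym_diff_involution: "sym_diff A (sym_diff A B) = B"
  by auto

lemma sum_sym_diff:
  fixes h :: "'g::finite set \<Rightarrow> 'b::comm_monoid_add"
  shows "(\<Sum>B\<in>UNIV. h (sym_diff A B)) = (\<Sum>B\<in>UNIV. h B)"
  by (rule sum.reindex_bij_witness [where i = "sym_diff A" and j = "sym_diff A"]) auto

instance clifford :: ("{finite, linorder}") ring_1
proof
  fix x y z :: "'a clifford"
  show "x * y * z = x * (y * z)"
  proof (rule clifford_eqI)
    fix D
    have "coeff (x * y * z) D = (\<Sum>C\<in>UNIV. \<Sum>A\<in>UNIV.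
        csign C (sym_diff C D) * csign A (sym_diff A C) *
        coeff x A * coeff y (sym_diff A C) * coeff z (sym_diff C D))"
      by (simp add: coeff_times sum_distrib_left sum_distrib_right mult_ac)
    also have "\<dots> = (\<Sum>A\<in>UNIV. \<Sum>C\<in>UNIV.
        csign C (sym_diff C D) * csign A (sym_diff A C) *
        coeff x A * coeff y (sym_diff A C) * coeff z (sym_diff C D))"
      by (rule sum.swap)
    also have "\<dots> = (\<Sum>A\<in>UNIV. \<Sum>B\<in>UNIV.
        csign (sym_diff A B) (sym_diff (sym_diff A B) D) * csign A B *
        coeff x A * coeff y B * coeff z (sym_diff (sym_diff A B) D))"
    proof (rule sum.cong [OF refl])
      fix A
      show "(\<Sum>C\<in>UNIV. csign C (sym_diff C D) * csign A (sym_diff A C) *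
          coeff x A * coeff y (sym_diff A C) * coeff z (sym_diff C D)) =
        (\<Sum>B\<in>UNIV. csign (sym_diff A B) (sym_diff (sym_diff A B) D) * csign A B *
          coeff x A * coeff y B * coeff z (sym_diff (sym_diff A B) D))"
        by (subst sum_sym_diff [of _ A, symmetric]) (simp add: sym_diff_involution)
    qed
    also have "\<dots> = (\<Sum>A\<in>UNIV. \<Sum>B\<in>UNIV.
        csign A (sym_diff A D) * csign B (sym_diff B (sym_diff A D)) *
        coeff x A * coeff y B * coeff z (sym_diff B (sym_diff A D)))"
    proof (intro sum.cong refl)
      fix A B :: "'a set"
      let ?E = "sym_diff (sym_diff A B) D"
      have 1: "sym_diff B (sym_diff A D) = ?E" and 2: "sym_diff A D = sym_diff B ?E"
        by auto
      have "csign (sym_diff A B) ?E * csign A B = csign A (sym_diff B ?E) * csign B ?E"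
        by (simp only: csign_sym_diff_left csign_sym_diff_right mult_ac)
      then show "csign (sym_diff A B) ?E * csign A B * coeff x A * coeff y B * coeff z ?E =
          csign A (sym_diff A D) * csign B (sym_diff B (sym_diff A D)) *
          coeff x A * coeff y B * coeff z (sym_diff B (sym_diff A D))"
        unfolding 1 by (simp only: 2 [symmetric])
    qed
    also have "\<dots> = coeff (x * (y * z)) D"
      by (simp add: coeff_times sum_distrib_left mult_ac)
    finally show "coeff (x * y * z) D = coeff (x * (y * z)) D" .
  qed
  show "1 * x = x"
    by (rule clifford_eqI) (simp add: coeff_times if_distrib if_distribR cong: if_cong)
  show "x * 1 = x"
  proof (rule clifford_eqI)
    fix C
    have "coeff (x * 1) C = (\<Sum>A\<in>UNIV. if A = C then coeff x A else 0)"
      unfolding coeff_times by (rule sum.cong) auto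
    then show "coeff (x * 1) C = coeff x C"
      by simp
  qed
  show "(x + y) * z = x * z + y * z" "x * (y + z) = x * y + x * z"
    by (rule clifford_eqI; simp add: coeff_times algebra_simps sum.distrib)+
  show "(0::'a clifford) \<noteq> 1"
    by (metis coeff_simps(1,2) zero_neq_one)
qed (auto intro!: clifford_eqI)

definition cscale :: "complex \<Rightarrow> 'g clifford \<Rightarrow> 'g clifford" where
  "cscale c x = Clifford (\<lambda>A. c * coeff x A)"

definition cvectors :: "'g clifford set" where
  "cvectors = {x. \<forall>A. card A \<noteq> 1 \<longrightarrow> coeff x A = 0}"

definition grade_inv :: "'g clifford \<Rightarrow> 'g clifford" where
  "grade_inv x = Clifford (\<lambda>A. (-1) ^ card A * coeff x A)"

definition witt_basis ::
  "('m::finite \<Rightarrow> 'g::{finite, linorder} clifford) \<Rightarrow> ('m \<Rightarrow> 'g clifford) \<Rightarrow> bool" where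
  "witt_basis f fd \<longleftrightarrow>
     CARD('g) = 2 * CARD('m) \<and>
     (\<forall>a. f a \<in> cvectors \<and> fd a \<in> cvectors) \<and>
     (\<forall>v\<in>cvectors. \<exists>c d. v = (\<Sum>a\<in>UNIV. cscale (c a) (f a) + cscale (d a) (fd a))) \<and>
     (\<forall>a b. f a * f b + f b * f a = 0) \<and>
     (\<forall>a b. fd a * fd b + fd b * fd a = 0) \<and>
     (\<forall>a b. f a * fd b + fd b * f a = (if a = b then 1 else 0))"

text \<open>\<open>is_contraction f fd a D\<close>: \<open>D\<close> is the odd antiderivation with \<open>D (f b) = \<delta>\<^sub>a\<^sub>b\<close> and
  \<open>D (fd b) = 0\<close>.  It is unique because a Witt basis generates the algebra.\<close>

definition is_contraction ::
  "('m \<Rightarrow> 'g::{finite, linorder} clifford) \<Rightarrow> ('m \<Rightarrow> 'g clifford) \<Rightarrow> 'm \<Rightarrow>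
   ('g clifford \<Rightarrow> 'g clifford) \<Rightarrow> bool" where
  "is_contraction f fd a D \<longleftrightarrow>
     (\<forall>x y. D (x + y) = D x + D y) \<and>
     (\<forall>c x. D (cscale c x) = cscale c (D x)) \<and>
     (\<forall>x. D (grade_inv x) = - grade_inv (D x)) \<and>
     (\<forall>x y. D (x * y) = D x * y + grade_inv x * D y) \<and>
     (\<forall>b. D (f b) = (if a = b then 1 else 0)) \<and>
     (\<forall>b. D (fd b) = 0)"


section \<open>Clifford-valued polynomials\<close>

text \<open>\<open>\<complex>[z, z\<^bold>-] \<otimes> Cl\<^sub>2\<^sub>m\<close> is the ring of polynomials in commuting variables (commuting also
  with the coefficients) with coefficients in \<open>Cl\<^sub>2\<^sub>m\<close>: finitely supported functions on the monoid
  of monomials, with the convolution product.  The index set \<open>{1..N}\<close> is the finite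
  linearly ordered type \<open>'n\<close>, and \<open>{1..m}\<close> is the finite type \<open>'m\<close>.\<close>

datatype ('n, 'm) var = Zv 'n 'm | Zbv 'n 'm

type_synonym ('n, 'm, 'g) cpoly = "(('n, 'm) var \<Rightarrow>\<^sub>0 nat) \<Rightarrow>\<^sub>0 'g clifford"

definition pvar :: "('n, 'm) var \<Rightarrow> ('n, 'm, 'g::{finite, linorder}) cpoly" where
  "pvar v = Poly_Mapping.single (Poly_Mapping.single v 1) 1"

definition pconst :: "'g clifford \<Rightarrow> ('n, 'm, 'g::{finite, linorder}) cpoly" where
  "pconst x = Poly_Mapping.single 0 x"

definition pdiff ::
  "('n, 'm) var \<Rightarrow> ('n, 'm, 'g::{finite, linorder}) cpoly \<Rightarrow> ('n, 'm, 'g) cpoly" where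
  "pdiff v p = (\<Sum>t\<in>Poly_Mapping.keys p. Poly_Mapping.single (t - Poly_Mapping.single v 1)
     (of_nat (Poly_Mapping.lookup t v) * Poly_Mapping.lookup p t))"

definition pcontr ::
  "('m \<Rightarrow> 'g clifford \<Rightarrow> 'g clifford) \<Rightarrow> 'm \<Rightarrow>
   ('n, 'm, 'g::{finite, linorder}) cpoly \<Rightarrow> ('n, 'm, 'g) cpoly" where
  "pcontr \<delta> a = Poly_Mapping.map (\<delta> a)"

definition s_op ::
  "('m::finite \<Rightarrow> 'g clifford \<Rightarrow> 'g clifford) \<Rightarrow> 'n \<Rightarrow>
   ('n, 'm, 'g::{finite, linorder}) cpoly \<Rightarrow> ('n, 'm, 'g) cpoly" where
  "s_op \<delta> i x = (\<Sum>a\<in>UNIV. pcontr \<delta> a (pdiff (Zv i a) x))"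

definition Ez ::
  "'n \<Rightarrow> 'n \<Rightarrow> ('n, 'm::finite, 'g::{finite, linorder}) cpoly \<Rightarrow> ('n, 'm, 'g) cpoly" where
  "Ez j i x = (\<Sum>a\<in>UNIV. pvar (Zv j a) * pdiff (Zv i a) x)"

definition Cz_entry ::
  "'n \<Rightarrow> 'n \<Rightarrow> ('n, 'm::finite, 'g::{finite, linorder}) cpoly \<Rightarrow> ('n, 'm, 'g) cpoly" where
  "Cz_entry i j x = (if i = j then of_nat CARD('m) * x else 0) + Ez j i x"

definition Cz ::
  "('n::finite \<Rightarrow> ('n, 'm::finite, 'g::{finite, linorder}) cpoly) \<Rightarrow>
   ('n \<Rightarrow> ('n, 'm, 'g) cpoly)" where
  "Cz p = (\<lambda>i. \<Sum>j\<in>UNIV. Cz_entry i j (p j))"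

text \<open>\<open>n_plus\<close> is the \<open>i\<close>-th entry of \<open>Cz\<close> inverse applied to the column \<open>(s\<^sub>l x)\<^sub>l\<close>.
  \<open>Cz\<close> preserves the homogeneous components of the space of columns, so where it is invertible
  its inverse on all columns is the direct sum of the inverses on the components.\<close>

definition n_plus ::
  "('m::finite \<Rightarrow> 'g clifford \<Rightarrow> 'g clifford) \<Rightarrow> 'n::finite \<Rightarrow>
   ('n, 'm, 'g::{finite, linorder}) cpoly \<Rightarrow> ('n, 'm, 'g) cpoly" where
  "n_plus \<delta> i x = inv Cz (\<lambda>l. s_op \<delta> l x) i"

definition B_plus ::
  "('m \<Rightarrow> 'g clifford \<Rightarrow> 'g clifford) \<Rightarrow> ('n, 'm, 'g::{finite, linorder}) cpoly set" where
  "B_plus \<delta> = {B. \<forall>a. pcontr \<delta> a B = 0}"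


section \<open>Radial words and label contraction\<close>

definition radial ::
  "('m::finite \<Rightarrow> 'g clifford) \<Rightarrow> 'n \<Rightarrow> ('n, 'm, 'g::{finite, linorder}) cpoly" where
  "radial f k = (\<Sum>a\<in>UNIV. pvar (Zv k a) * pconst (f a))"

definition radial_dag ::
  "('m::finite \<Rightarrow> 'g clifford) \<Rightarrow> 'n \<Rightarrow> ('n, 'm, 'g::{finite, linorder}) cpoly" where
  "radial_dag fd k = (\<Sum>a\<in>UNIV. pvar (Zbv k a) * pconst (fd a))"

definition ordered_word :: "('n::{finite, linorder} \<Rightarrow> 'b::monoid_mult) \<Rightarrow> 'n set \<Rightarrow> 'b" where
  "ordered_word Z I = prod_list (map Z (sorted_list_of_set I))"

text \<open>
  Elements of the formal radial module are families \<open>\<phi>\<close> of coefficients indexed by the ordered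
  subsets \<open>I\<close>; \<open>\<phi>\<close> represents the element \<open>\<Sum>\<^sub>I Z\<^sub>I \<phi>\<^sub>I\<close> (with a single \<open>\<phi>\<^sub>I\<close> suffices for
  each \<open>I\<close>, since the coefficients form a subspace).  The label contraction acts on the labels \<open>I\<close>,
  hence on such families: for \<open>m < N\<close> the words \<open>Z\<^sub>I B\<close> satisfy linear relations that it does
  not respect (for \<open>m = 1\<close>, \<open>Z\<^sub>1 z\<^sub>2\<^sub>1 = Z\<^sub>2 z\<^sub>1\<^sub>1\<close>).
\<close>

definition pbw_plus ::
  "('m::finite \<Rightarrow> 'g clifford) \<Rightarrow>
   ('n::{finite, linorder} set \<Rightarrow> ('n, 'm, 'g::{finite, linorder}) cpoly) \<Rightarrow> ('n, 'm, 'g) cpoly" where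
  "pbw_plus f \<phi> = (\<Sum>I\<in>UNIV. ordered_word (radial f) I * \<phi> I)"

definition pbw_minus ::
  "('m::finite \<Rightarrow> 'g clifford) \<Rightarrow>
   ('n::{finite, linorder} set \<Rightarrow> ('n, 'm, 'g::{finite, linorder}) cpoly) \<Rightarrow> ('n, 'm, 'g) cpoly" where
  "pbw_minus fd \<phi> = (\<Sum>I\<in>UNIV. ordered_word (radial_dag fd) I * \<phi> I)"

text \<open>Positions in the list of elements of \<open>I\<close> start at \<open>0\<close>, so that the sign is \<open>(-1)\<^sup>t\<close>.\<close>

definition c_plus_word ::
  "('m::finite \<Rightarrow> 'g clifford) \<Rightarrow> 'n::{finite, linorder} \<Rightarrow> 'n set \<Rightarrow>
   ('n, 'm, 'g::{finite, linorder}) cpoly \<Rightarrow> ('n, 'm, 'g) cpoly" where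
  "c_plus_word f i I B =
     (\<Sum>t<card I. (-1) ^ t * (if i = sorted_list_of_set I ! t then 1 else 0) *
        ordered_word (radial f) (I - {sorted_list_of_set I ! t}) * B)"

definition c_plus ::
  "('m::finite \<Rightarrow> 'g clifford) \<Rightarrow> 'n::{finite, linorder} \<Rightarrow>
   ('n set \<Rightarrow> ('n, 'm, 'g::{finite, linorder}) cpoly) \<Rightarrow> ('n, 'm, 'g) cpoly" where
  "c_plus f i \<phi> = (\<Sum>I\<in>UNIV. c_plus_word f i I (\<phi> I))"


section \<open>Order-preserving Hermitian conjugation\<close>

definition is_herm_conj ::
  "('m \<Rightarrow> 'g clifford) \<Rightarrow> ('m \<Rightarrow> 'g clifford) \<Rightarrow>
   (('n, 'm, 'g::{finite, linorder}) cpoly \<Rightarrow> ('n, 'm, 'g) cpoly) \<Rightarrow> bool" where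
  "is_herm_conj f fd \<kappa> \<longleftrightarrow>
     (\<forall>x y. \<kappa> (x + y) = \<kappa> x + \<kappa> y) \<and>
     (\<forall>x y. \<kappa> (x * y) = \<kappa> x * \<kappa> y) \<and>
     (\<forall>c x. \<kappa> (pconst (cscale c 1) * x) = pconst (cscale (cnj c) 1) * \<kappa> x) \<and>
     (\<forall>x. \<kappa> (\<kappa> x) = x) \<and>
     (\<forall>k a. \<kappa> (pvar (Zv k a)) = pvar (Zbv k a) \<and> \<kappa> (pvar (Zbv k a)) = pvar (Zv k a)) \<and>
     (\<forall>a. \<kappa> (pconst (f a)) = pconst (fd a) \<and> \<kappa> (pconst (fd a)) = pconst (f a))"

definition conj_op :: "('b \<Rightarrow> 'b) \<Rightarrow> ('b \<Rightarrow> 'b) \<Rightarrow> 'b \<Rightarrow> 'b" where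
  "conj_op \<kappa> T = \<kappa> \<circ> T \<circ> \<kappa>"

definition n_minus ::
  "('m::finite \<Rightarrow> 'g clifford \<Rightarrow> 'g clifford) \<Rightarrow>
   (('n, 'm, 'g) cpoly \<Rightarrow> ('n, 'm, 'g) cpoly) \<Rightarrow> 'n::finite \<Rightarrow>
   ('n, 'm, 'g::{finite, linorder}) cpoly \<Rightarrow> ('n, 'm, 'g) cpoly" where
  "n_minus \<delta> \<kappa> i = conj_op \<kappa> (n_plus \<delta> i)"

definition B_minus ::
  "('m \<Rightarrow> 'g clifford \<Rightarrow> 'g clifford) \<Rightarrow>
   (('n, 'm, 'g) cpoly \<Rightarrow> ('n, 'm, 'g) cpoly) \<Rightarrow> ('n, 'm, 'g::{finite, linorder}) cpoly set" where
  "B_minus \<delta> \<kappa> = \<kappa> ` B_plus \<delta>"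

text \<open>Conjugation sends the plus word with data \<open>(I, B)\<close> to the minus word with data \<open>(I, \<kappa> B)\<close>.\<close>

definition c_minus_word ::
  "('m::finite \<Rightarrow> 'g clifford) \<Rightarrow> (('n, 'm, 'g) cpoly \<Rightarrow> ('n, 'm, 'g) cpoly) \<Rightarrow>
   'n::{finite, linorder} \<Rightarrow> 'n set \<Rightarrow>
   ('n, 'm, 'g::{finite, linorder}) cpoly \<Rightarrow> ('n, 'm, 'g) cpoly" where
  "c_minus_word f \<kappa> i I = conj_op \<kappa> (c_plus_word f i I)"

definition c_minus ::
  "('m::finite \<Rightarrow> 'g clifford) \<Rightarrow> (('n, 'm, 'g) cpoly \<Rightarrow> ('n, 'm, 'g) cpoly) \<Rightarrow>
   'n::{finite, linorder} \<Rightarrow>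
   ('n set \<Rightarrow> ('n, 'm, 'g::{finite, linorder}) cpoly) \<Rightarrow> ('n, 'm, 'g) cpoly" where
  "c_minus f \<kappa> i \<phi> = (\<Sum>I\<in>UNIV. c_minus_word f \<kappa> i I (\<phi> I))"


section \<open>Existence of the structures\<close>

text \<open>A Witt basis of \<open>Cl\<^sub>2\<^sub>m\<close> exists, every Witt basis has its contractions (given by the graded
  commutators with \<open>fd a\<close>), and together with the standard Witt basis there is an order-preserving Hermitian
  conjugation.\<close>

definition cgen :: "'g::{finite, linorder} \<Rightarrow> 'g clifford" where
  "cgen g = Clifford (\<lambda>A. if A = {g} then 1 else 0)"

lemma coeff_cgen [simp]: "coeff (cgen g) A = (if A = {g} then 1 else 0)"
  by (simp add: cgen_def)

lemma coeff_cscale [simp]: "coeff (cscale c x) A = c * coeff x A"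
  by (simp add: cscale_def)

lemma coeff_sum: "coeff (\<Sum>i\<in>S. h i) A = (\<Sum>i\<in>S. coeff (h i) A)"
  by (induction S rule: infinite_finite_induct) auto

lemma cscale_algebra:
  fixes x y :: "'g::{finite, linorder} clifford"
  shows "cscale c x * y = cscale c (x * y)" "x * cscale c y = cscale c (x * y)"
    "cscale c (x + y) = cscale c x + cscale c y" "cscale c (x - y) = cscale c x - cscale c y"
    "cscale c (cscale d x) = cscale (c * d) x" "cscale 0 x = 0" "cscale c 0 = 0" "cscale 1 x = x"
    "cscale c (- x) = - cscale c x"
  by (rule clifford_eqI; simp add: coeff_times sum_distrib_left algebra_simps)+

lemma cgen_anticommute: "cgen g * cgen h + cgen h * cgen g = (if g = h then cscale 2 1 else 0)"
proof (rule clifford_eqI)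
  fix C
  have *: "coeff (cgen g * cgen h) C = (if C = sym_diff {g} {h} then csign {g} {h} else 0)" for g h :: 'a
  proof -
    have eq: "sym_diff {g} C = {h} \<longleftrightarrow> C = sym_diff {g} {h}"
      by (metis sym_diff_involution)
    have "coeff (cgen g * cgen h) C =
        (\<Sum>A\<in>UNIV. if A = {g} then csign A (sym_diff A C) * (if sym_diff A C = {h} then 1 else 0) else 0)"
      unfolding coeff_times by (rule sum.cong) auto
    also have "\<dots> = csign {g} (sym_diff {g} C) * (if sym_diff {g} C = {h} then 1 else 0)"
      by (subst sum.delta) auto
    also have "\<dots> = (if C = sym_diff {g} {h} then csign {g} {h} else 0)"
      using eq by auto
    finally show ?thesis .
  qed
  have s: "csign {g} {h} = (if h < g then -1 else 1)" for g h :: 'a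
    by (simp add: csign_prod)
  show "coeff (cgen g * cgen h + cgen h * cgen g) C = coeff (if g = h then cscale 2 1 else 0) C"
    unfolding coeff_simps * s by (auto simp: not_less)
qed

lemma grade_inv_simps:
  fixes x y :: "'g::{finite, linorder} clifford"
  shows "grade_inv (x + y) = grade_inv x + grade_inv y" "grade_inv (x - y) = grade_inv x - grade_inv y"
    "grade_inv (cscale c x) = cscale c (grade_inv x)" "grade_inv (grade_inv x) = x"
    "grade_inv (- x) = - grade_inv x"
  by (rule clifford_eqI; simp add: grade_inv_def algebra_simps flip: power_add mult_2)+

lemma grade_inv_vector:
  fixes x :: "'g::{finite, linorder} clifford"
  assumes "x \<in> cvectors"
  shows "grade_inv x = - x"
  using assms by (intro clifford_eqI) (metis (mono_tags, lifting) clifford.sel cvectors_def grade_inv_def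
      coeff_simps(5) mem_Collect_eq mult_minus1 mult_zero_right neg_0_equal_iff_equal power_one_right)

lemma grade_inv_mult:
  fixes x y :: "'g::{finite, linorder} clifford"
  shows "grade_inv (x * y) = grade_inv x * grade_inv y"
proof (rule clifford_eqI)
  fix C :: "'g set"
  have *: "(-1) ^ card C = (-1::complex) ^ card A * (-1) ^ card (sym_diff A C)" for A
    using prod_sym_diff_sign [of "\<lambda>_::'g. -1" A "sym_diff A C"] by (simp add: sym_diff_involution)
  have "(-1) ^ card C * (csign A (sym_diff A C) * coeff x A * coeff y (sym_diff A C)) =
      csign A (sym_diff A C) * ((-1) ^ card A * coeff x A) *
      ((-1) ^ card (sym_diff A C) * coeff y (sym_diff A C))" for A
    by (subst * [of A]) (simp only: mult_ac)
  then show "coeff (grade_inv (x * y)) C = coeff (grade_inv x * grade_inv y) C"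
    by (simp only: grade_inv_def coeff_times sum_distrib_left clifford.sel)
qed

lemma is_contraction_exists:
  assumes "witt_basis f fd"
  shows "is_contraction f fd a (\<lambda>x. fd a * x - grade_inv x * fd a)"
proof -
  have v: "grade_inv (f b) = - f b" "grade_inv (fd b) = - fd b" for b
    using assms grade_inv_vector by (auto simp: witt_basis_def)
  show ?thesis
    using assms unfolding is_contraction_def witt_basis_def
    by (auto simp: grade_inv_simps grade_inv_mult cscale_algebra v algebra_simps)
qed

definition ccnj :: "'g clifford \<Rightarrow> 'g clifford" where
  "ccnj x = Clifford (\<lambda>A. cnj (coeff x A))"

lemma ccnj_simps [simp]:
  fixes x y :: "'g::{finite, linorder} clifford"
  shows "ccnj (x + y) = ccnj x + ccnj y" "ccnj (x * y) = ccnj x * ccnj y"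
    "ccnj (cscale c x) = cscale (cnj c) (ccnj x)" "ccnj (ccnj x) = x" "ccnj (cgen g) = cgen g"
    "ccnj 1 = 1" "ccnj 0 = 0" "ccnj (- x) = - ccnj x" "ccnj (x - y) = ccnj x - ccnj y"
  by (rule clifford_eqI; simp add: ccnj_def coeff_times csign_def)+

lemma witt_basis_exists:
  assumes "CARD('g::{finite, linorder}) = 2 * CARD('m::finite)"
  shows "\<exists>f :: 'm \<Rightarrow> 'g clifford. witt_basis f (\<lambda>a. ccnj (f a))"
proof -
  have "CARD('m \<times> bool) = CARD('g)"
    using assms by simp
  then obtain \<beta> :: "'m \<times> bool \<Rightarrow> 'g" where \<beta>: "bij \<beta>"
    by (metis finite_same_card_bij finite)
  then have inj: "\<beta> p = \<beta> q \<longleftrightarrow> p = q" for p q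
    by (meson bij_def injD)
  define f where "f a = cscale (1/2) (cgen (\<beta> (a, True)) + cscale \<i> (cgen (\<beta> (a, False))))" for a
  have fd: "ccnj (f a) = cscale (1/2) (cgen (\<beta> (a, True)) + cscale (-\<i>) (cgen (\<beta> (a, False))))" for a
    by (simp add: f_def)
  have ac: "cscale (1/2) (cgen p + cscale c (cgen q)) * cscale (1/2) (cgen r + cscale d (cgen s)) +
      cscale (1/2) (cgen r + cscale d (cgen s)) * cscale (1/2) (cgen p + cscale c (cgen q)) =
      cscale (((if p = r then 1 else 0) + d * (if p = s then 1 else 0) + c * (if q = r then 1 else 0) +
        c * d * (if q = s then 1 else 0)) / 2) 1" for p q r s :: 'g and c d
  proof -
    have "cscale (1/2) (cgen p + cscale c (cgen q)) * cscale (1/2) (cgen r + cscale d (cgen s)) +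
      cscale (1/2) (cgen r + cscale d (cgen s)) * cscale (1/2) (cgen p + cscale c (cgen q)) =
      cscale (1/4) ((cgen p * cgen r + cgen r * cgen p) + cscale d (cgen p * cgen s + cgen s * cgen p)
       + cscale c (cgen q * cgen r + cgen r * cgen q) + cscale (c * d) (cgen q * cgen s + cgen s * cgen q))"
      by (simp add: cscale_algebra algebra_simps)
    also have "\<dots> = cscale (((if p = r then 1 else 0) + d * (if p = s then 1 else 0) + c * (if q = r then 1 else 0) +
        c * d * (if q = s then 1 else 0)) / 2) 1"
      unfolding cgen_anticommute by (rule clifford_eqI) (simp add: field_simps)
    finally show ?thesis .
  qed
  have vec: "f a \<in> cvectors" "ccnj (f a) \<in> cvectors" for a
    unfolding cvectors_def fd by (auto simp: f_def)
  have span: "\<exists>c d. v = (\<Sum>a\<in>UNIV. cscale (c a) (f a) + cscale (d a) (ccnj (f a)))"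
    if "v \<in> cvectors" for v
  proof (intro exI)
    let ?x = "\<lambda>p. coeff v {\<beta> p}"
    show "v = (\<Sum>a\<in>UNIV. cscale (?x (a, True) - \<i> * ?x (a, False)) (f a) +
        cscale (?x (a, True) + \<i> * ?x (a, False)) (ccnj (f a)))"
    proof (rule clifford_eqI)
      fix A
      have 1: "coeff (cscale (?x (a, True) - \<i> * ?x (a, False)) (f a) +
          cscale (?x (a, True) + \<i> * ?x (a, False)) (ccnj (f a))) A =
          ?x (a, True) * coeff (cgen (\<beta> (a, True))) A + ?x (a, False) * coeff (cgen (\<beta> (a, False))) A" for a
        unfolding fd by (simp add: f_def field_simps)
      have "(\<Sum>a\<in>UNIV. coeff (cscale (?x (a, True) - \<i> * ?x (a, False)) (f a) +
          cscale (?x (a, True) + \<i> * ?x (a, False)) (ccnj (f a))) A) =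
          (\<Sum>a\<in>UNIV. \<Sum>b\<in>UNIV. ?x (a, b) * coeff (cgen (\<beta> (a, b))) A)"
        unfolding 1 by (simp add: UNIV_bool add.commute)
      also have "\<dots> = (\<Sum>p\<in>UNIV. ?x p * coeff (cgen (\<beta> p)) A)"
        by (simp add: sum.cartesian_product case_prod_unfold)
      also have "\<dots> = (\<Sum>g\<in>UNIV. coeff v {g} * coeff (cgen g) A)"
        using \<beta> by (rule sum.reindex_bij_betw)
      also have "\<dots> = coeff v A"
      proof (cases "card A = 1")
        case True
        then obtain g where "A = {g}"
          using card_1_singletonE by blast
        then show ?thesis
          by (simp add: if_distrib cong: if_cong)
      next
        case False
        then have "coeff v A = 0" "\<And>g. A \<noteq> {g}"
          using that by (auto simp: cvectors_def)
        then show ?thesis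
          by simp
      qed
      finally show "coeff v A = coeff (\<Sum>a\<in>UNIV. cscale (?x (a, True) - \<i> * ?x (a, False)) (f a) +
          cscale (?x (a, True) + \<i> * ?x (a, False)) (ccnj (f a))) A"
        by (simp only: coeff_sum)
    qed
  qed
  have "f a * f b + f b * f a = 0" for a b
    unfolding f_def ac by (simp add: inj cscale_algebra)
  moreover have "ccnj (f a) * ccnj (f b) + ccnj (f b) * ccnj (f a) = 0" for a b
    unfolding fd ac by (simp add: inj cscale_algebra)
  moreover have "f a * ccnj (f b) + ccnj (f b) * f a = (if a = b then 1 else 0)" for a b
    unfolding fd unfolding f_def ac by (simp add: inj cscale_algebra)
  ultimately have "witt_basis f (\<lambda>a. ccnj (f a))"
    unfolding witt_basis_def using assms vec span by simp
  then show ?thesis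
    by (rule exI [of _ f])
qed

fun bar_var :: "('n, 'm) var \<Rightarrow> ('n, 'm) var" where
  "bar_var (Zv k a) = Zbv k a"
| "bar_var (Zbv k a) = Zv k a"

lemma bar_var_bar_var [simp]: "bar_var (bar_var v) = v"
  by (cases v) auto

lemma inj_bar_var [simp]: "inj bar_var"
  by (metis bar_var_bar_var injI)

abbreviation bar_mon :: "(('n, 'm) var \<Rightarrow>\<^sub>0 nat) \<Rightarrow> (('n, 'm) var \<Rightarrow>\<^sub>0 nat)" where
  "bar_mon \<equiv> Poly_Mapping.map_key bar_var"

lemma bar_mon_simps [simp]:
  "bar_mon (bar_mon t) = t" "bar_mon (s + t) = bar_mon s + bar_mon t"
  "bar_mon (Poly_Mapping.single v n) = Poly_Mapping.single (bar_var v) n"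
  by (rule poly_mapping_eqI; simp add: map_key.rep_eq lookup_add lookup_single when_def; metis bar_var_bar_var)+

lemma inj_bar_mon [simp]: "inj bar_mon"
  by (metis bar_mon_simps(1) injI)

definition hconj0 :: "('n, 'm, 'g::{finite, linorder}) cpoly \<Rightarrow> ('n, 'm, 'g) cpoly" where
  "hconj0 p = Poly_Mapping.map_key bar_mon (Poly_Mapping.map ccnj p)"

lemma lookup_hconj0: "Poly_Mapping.lookup (hconj0 p) t = ccnj (Poly_Mapping.lookup p (bar_mon t))"
  by (simp add: hconj0_def map_key.rep_eq map.rep_eq when_def)

lemma hconj0_simps:
  "hconj0 (x + y) = hconj0 x + hconj0 y" "hconj0 (hconj0 x) = x" "hconj0 0 = 0"
  "hconj0 (Poly_Mapping.single t c) = Poly_Mapping.single (bar_mon t) (ccnj c)"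
  by (rule poly_mapping_eqI; simp add: lookup_hconj0 lookup_add lookup_single when_def;
      metis bar_mon_simps(1))+

lemma hconj0_sum: "hconj0 (\<Sum>i\<in>S. h i) = (\<Sum>i\<in>S. hconj0 (h i))"
  by (induction S rule: infinite_finite_induct) (auto simp: hconj0_simps)

lemma cpoly_sum_single:
  "p = (\<Sum>t\<in>Poly_Mapping.keys p. Poly_Mapping.single t (Poly_Mapping.lookup p t))"
  by (rule poly_mapping_eqI) (simp add: lookup_sum lookup_single when_def in_keys_iff)

lemma hconj0_mult: "hconj0 (x * y) = hconj0 x * hconj0 y"
proof -
  have 1: "hconj0 (Poly_Mapping.single s c * y) = hconj0 (Poly_Mapping.single s c) * hconj0 y" for s c
    by (subst (1 2) cpoly_sum_single [of y]) (simp add: sum_distrib_left hconj0_sum mult_single hconj0_simps)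
  show ?thesis
    by (subst (1 2) cpoly_sum_single [of x]) (simp add: sum_distrib_right hconj0_sum 1)
qed

lemma standard_setting_exists:
  assumes "CARD('g::{finite, linorder}) = 2 * CARD('m::finite)"
  shows "\<exists>(f :: 'm \<Rightarrow> 'g clifford) fd \<delta> (\<kappa> :: ('n, 'm, 'g) cpoly \<Rightarrow> ('n, 'm, 'g) cpoly).
    witt_basis f fd \<and> (\<forall>a. is_contraction f fd a (\<delta> a)) \<and> is_herm_conj f fd \<kappa>"
proof -
  obtain f :: "'m \<Rightarrow> 'g clifford" where f: "witt_basis f (\<lambda>a. ccnj (f a))"
    using witt_basis_exists [OF assms] ..
  have "is_herm_conj f (\<lambda>a. ccnj (f a)) (hconj0 :: ('n, 'm, 'g) cpoly \<Rightarrow> ('n, 'm, 'g) cpoly)"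
    by (simp add: is_herm_conj_def hconj0_mult hconj0_simps pconst_def pvar_def)
  then show ?thesis
    using f is_contraction_exists [OF f]
    by (intro exI [of _ f] exI [of _ "\<lambda>a. ccnj (f a)"]
        exI [of _ "\<lambda>a x. ccnj (f a) * x - grade_inv x * ccnj (f a)"] exI [of _ hconj0]) simp
qed

end

theory Submission
  imports Defs
begin

text \<open>
  Since \<open>m \<delta>\<^sub>i\<^sub>l + E\<^sub>l\<^sub>i\<close> is the operator \<open>\<Sum>\<^sub>a \<partial>\<^sub>i\<^sub>a z\<^sub>l\<^sub>a\<close>, the operator matrix \<open>Cz\<close> is the product
  of the matrix of the derivatives with the matrix of the variables \<open>z\<close>.  The antiderivation
  property gives \<open>\<delta>\<^sub>a (Z\<^sub>I B) = \<Sum>\<^sub>l z\<^sub>l\<^sub>a c\<^sub>l (Z\<^sub>I B)\<close>, and applying \<open>\<Sum>\<^sub>a \<partial>\<^sub>i\<^sub>a\<close> yields the radial identity.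
  For the Fischer inner product \<open>\<partial>\<^sub>i\<^sub>a\<close> is adjoint to \<open>z\<^sub>i\<^sub>a\<close>, so \<open>Cz\<close> has the same kernel as the
  matrix of the \<open>z\<close>s, which is zero as soon as \<open>m \<ge> N\<close>.  Hence \<open>inv Cz\<close> recovers the contractions from
  the column of the \<open>s\<^sub>i\<close>, whether or not \<open>Cz\<close> is onto.
\<close>

section \<open>Coefficients of products and derivatives of Clifford-valued polynomials\<close>

lemma lookup_pvar_mult:
  fixes p :: "('n, 'm, 'g::{finite, linorder}) cpoly"
  shows "Poly_Mapping.lookup (pvar v * p) t =
    (if Poly_Mapping.lookup t v = 0 then 0
     else Poly_Mapping.lookup p (t - Poly_Mapping.single v 1))"
  (is "?L = ?R")
proof -
  let ?e = "Poly_Mapping.single v (1::nat)"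
  have single: "Poly_Mapping.lookup (Poly_Mapping.single (?e + s) c) t =
      (if Poly_Mapping.lookup t v = 0 then 0
       else Poly_Mapping.lookup (Poly_Mapping.single s c) (t - ?e))" for s and c :: "'g clifford"
  proof -
    \<comment> \<open>Exponents are subtracted with truncation at 0, so \<open>t - ?e\<close> is a
      true quotient only if \<open>v\<close> divides \<open>t\<close>.\<close>
    have "?e + s = t \<longleftrightarrow> Poly_Mapping.lookup t v \<noteq> 0 \<and> s = t - ?e"
      by (auto simp: poly_mapping_eq_iff fun_eq_iff lookup_add lookup_minus lookup_single when_def
          split: if_splits)
    then show ?thesis
      by (auto simp: lookup_single when_def)
  qed
  have "?L = Poly_Mapping.lookup (\<Sum>s\<in>Poly_Mapping.keys p.
      Poly_Mapping.single (?e + s) (Poly_Mapping.lookup p s)) t"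
    by (subst cpoly_sum_single [of p]) (simp add: pvar_def sum_distrib_left mult_single)
  also have "\<dots> = (if Poly_Mapping.lookup t v = 0 then 0 else Poly_Mapping.lookup
      (\<Sum>s\<in>Poly_Mapping.keys p. Poly_Mapping.single s (Poly_Mapping.lookup p s)) (t - ?e))"
    by (simp add: lookup_sum single del: One_nat_def)
  also have "\<dots> = ?R"
    by (simp flip: cpoly_sum_single)
  finally show ?thesis .
qed

lemma lookup_pvar_mult_add:
  "Poly_Mapping.lookup (pvar v * p) (t + Poly_Mapping.single v 1) = Poly_Mapping.lookup p t"
  by (simp add: lookup_pvar_mult lookup_add)

lemma lookup_pconst_mult: "Poly_Mapping.lookup (pconst x * p) t = x * Poly_Mapping.lookup p t"
proof -
  have "Poly_Mapping.lookup (pconst x * p) t = Poly_Mapping.lookup (\<Sum>s\<in>Poly_Mapping.keys p.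
      Poly_Mapping.single s (x * Poly_Mapping.lookup p s)) t"
    by (subst cpoly_sum_single [of p]) (simp add: pconst_def sum_distrib_left mult_single)
  also have "\<dots> = x * Poly_Mapping.lookup p t"
    by (simp add: lookup_sum lookup_single when_def in_keys_iff)
  finally show ?thesis .
qed

lemma lookup_pdiff:
  fixes p :: "('n, 'm, 'g::{finite, linorder}) cpoly"
  shows "Poly_Mapping.lookup (pdiff v p) t =
    of_nat (Poly_Mapping.lookup t v + 1) * Poly_Mapping.lookup p (t + Poly_Mapping.single v 1)"
proof -
  let ?e = "Poly_Mapping.single v (1::nat)"
  \<comment> \<open>If \<open>v\<close> does not divide \<open>s\<close>, the truncated
    \<open>s - ?e\<close> is \<open>s\<close> itself, but the factor \<open>lookup s v\<close> is
    then 0.\<close>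
  have single: "Poly_Mapping.lookup (Poly_Mapping.single (s - ?e) (of_nat (Poly_Mapping.lookup s v) * c)) t =
      (if s = t + ?e then of_nat (Poly_Mapping.lookup t v + 1) * c else 0)" for s and c :: "'g clifford"
  proof (cases "Poly_Mapping.lookup s v = 0")
    case True
    then have "s \<noteq> t + ?e"
      by (auto simp: lookup_add)
    with True show ?thesis
      by simp
  next
    case False
    then have "s - ?e = t \<longleftrightarrow> s = t + ?e"
      by (auto simp: poly_mapping_eq_iff fun_eq_iff lookup_add lookup_minus lookup_single when_def
          split: if_splits)
    then show ?thesis
      by (auto simp: lookup_single when_def lookup_add)
  qed
  show ?thesis
    unfolding pdiff_def lookup_sum single by (simp add: in_keys_iff)
qed

text \<open>The ring is noncommutative through its coefficients only; a variable has coefficient 1,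
  hence is central.\<close>

lemma pvar_commute: "p * pvar v = pvar v * p"
proof -
  have "p * pvar v = (\<Sum>s\<in>Poly_Mapping.keys p. Poly_Mapping.single s (Poly_Mapping.lookup p s) * pvar v)"
    by (subst cpoly_sum_single [of p]) (simp add: sum_distrib_right)
  also have "\<dots> = (\<Sum>s\<in>Poly_Mapping.keys p. pvar v * Poly_Mapping.single s (Poly_Mapping.lookup p s))"
    by (simp add: pvar_def mult_single add.commute)
  also have "\<dots> = pvar v * p"
    by (subst (3) cpoly_sum_single [of p]) (simp add: sum_distrib_left)
  finally show ?thesis .
qed

lemma pdiff_add: "pdiff v (p + q) = pdiff v p + pdiff v q"
  by (rule poly_mapping_eqI) (simp add: lookup_pdiff lookup_add distrib_left)

lemma pdiff_0: "pdiff v 0 = 0"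
  by (simp add: pdiff_def)

lemma pdiff_diff: "pdiff v (p - q) = pdiff v p - pdiff v q"
  by (rule poly_mapping_eqI) (simp add: lookup_pdiff lookup_minus right_diff_distrib)

lemma pdiff_sum: "pdiff v (\<Sum>i\<in>S. h i) = (\<Sum>i\<in>S. pdiff v (h i))"
  by (induction S rule: infinite_finite_induct) (auto simp: pdiff_add pdiff_0)

text \<open>The Weyl algebra relation between a derivative and a variable. Its commutator term is
  the source of the scalar part of \<open>Cz\<close>.\<close>

lemma pdiff_pvar_mult: "pdiff v (pvar w * p) = (if v = w then p else 0) + pvar w * pdiff v p"
proof (rule poly_mapping_eqI)
  fix t
  let ?e = "\<lambda>v. Poly_Mapping.single v (1::nat)"
  have *: "t - ?e w + ?e v = t + ?e v - ?e w" if "Poly_Mapping.lookup t w \<noteq> 0"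
    using that by (auto simp: poly_mapping_eq_iff fun_eq_iff lookup_add lookup_minus lookup_single when_def)
  show "Poly_Mapping.lookup (pdiff v (pvar w * p)) t =
      Poly_Mapping.lookup ((if v = w then p else 0) + pvar w * pdiff v p) t"
  proof (cases "v = w")
    case True
    then show ?thesis
      using * by (auto simp: lookup_pdiff lookup_pvar_mult lookup_add lookup_minus distrib_right)
  next
    case False
    then show ?thesis
      using * by (auto simp: lookup_pdiff lookup_pvar_mult lookup_add lookup_minus lookup_single when_def)
  qed
qed

section \<open>Factorization of the operator matrix\<close>

definition zcol_sum ::
  "('n::finite \<Rightarrow> ('n, 'm, 'g::{finite, linorder}) cpoly) \<Rightarrow> 'm \<Rightarrow> ('n, 'm, 'g) cpoly" where
  "zcol_sum p a = (\<Sum>l\<in>UNIV. pvar (Zv l a) * p l)"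

text \<open>Moving the derivatives past the variables leaves one copy of \<open>p i\<close> for each
  \<open>a\<close>; these \<open>CARD('m)\<close> copies are the diagonal part of
  \<open>Cz\<close>.\<close>

lemma Cz_eq_pdiff_zcol_sum: "Cz p i = (\<Sum>a\<in>UNIV. pdiff (Zv i a) (zcol_sum p a))"
proof -
  have "(\<Sum>a\<in>UNIV. pdiff (Zv i a) (zcol_sum p a)) =
      (\<Sum>l\<in>UNIV. \<Sum>a\<in>UNIV. (if i = l then p l else 0) + pvar (Zv l a) * pdiff (Zv i a) (p l))"
    unfolding zcol_sum_def pdiff_sum pdiff_pvar_mult by (subst sum.swap) simp
  also have "\<dots> = Cz p i"
    unfolding Cz_def Cz_entry_def Ez_def by (intro sum.cong refl) (simp add: sum.distrib)
  finally show ?thesis ..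
qed

section \<open>Contraction of radial words\<close>

context
  fixes f fd :: "'m::finite \<Rightarrow> 'g::{finite, linorder} clifford"
    and \<delta> :: "'m \<Rightarrow> 'g clifford \<Rightarrow> 'g clifford"
  assumes wb: "witt_basis f fd"
    and contr: "\<And>a. is_contraction f fd a (\<delta> a)"
begin

text \<open>The minus sign comes from grade inversion, which negates the vector
  \<open>f b\<close>.\<close>

lemma contraction_simps:
  "\<delta> a (x + y) = \<delta> a x + \<delta> a y"
  "\<delta> a (f b * y) = (if a = b then 1 else 0) * y - f b * \<delta> a y"
  using contr [of a] wb grade_inv_vector [of "f b"]
  by (auto simp: is_contraction_def witt_basis_def)

lemma contraction_0: "\<delta> a 0 = 0"
  using contraction_simps(1) [of a 0 0] by simp

lemma contraction_of_nat_mult: "\<delta> a (of_nat k * x) = of_nat k * \<delta> a x"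
  by (induction k) (simp_all add: contraction_0 contraction_simps(1) distrib_right)

text \<open>\<open>Poly_Mapping.map\<close> acts only on the support, so coefficientwise evaluation
  rests on \<open>\<delta> a 0 = 0\<close>.\<close>

lemma lookup_pcontr: "Poly_Mapping.lookup (pcontr \<delta> a p) t = \<delta> a (Poly_Mapping.lookup p t)"
  by (simp add: pcontr_def map.rep_eq when_def contraction_0)

lemma pcontr_add: "pcontr \<delta> a (p + q) = pcontr \<delta> a p + pcontr \<delta> a q"
  by (rule poly_mapping_eqI) (simp add: lookup_pcontr lookup_add contraction_simps)

lemma pcontr_sum: "pcontr \<delta> a (\<Sum>i\<in>S. h i) = (\<Sum>i\<in>S. pcontr \<delta> a (h i))"
  by (induction S rule: infinite_finite_induct)
    (auto simp: pcontr_add intro!: poly_mapping_eqI simp: lookup_pcontr contraction_0)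

lemma pcontr_pdiff: "pcontr \<delta> a (pdiff v p) = pdiff v (pcontr \<delta> a p)"
  by (rule poly_mapping_eqI) (simp only: lookup_pcontr lookup_pdiff contraction_of_nat_mult)

lemma pcontr_pvar_mult: "pcontr \<delta> a (pvar v * p) = pvar v * pcontr \<delta> a p"
  by (rule poly_mapping_eqI) (simp add: lookup_pcontr lookup_pvar_mult contraction_0)

lemma pcontr_pconst_mult:
  "pcontr \<delta> a (pconst (f b) * p) = (if a = b then p else 0) - pconst (f b) * pcontr \<delta> a p"
  by (rule poly_mapping_eqI)
    (simp add: lookup_pcontr lookup_pconst_mult lookup_minus contraction_simps)

text \<open>A radial variable is odd, and among its summands only the one with \<open>b = a\<close>
  has a nonzero contraction.\<close>

lemma pcontr_radial_mult:
  "pcontr \<delta> a (radial f k * p) = pvar (Zv k a) * p - radial f k * pcontr \<delta> a p"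
proof -
  have "pcontr \<delta> a (radial f k * p) = (\<Sum>b\<in>UNIV. pvar (Zv k b) *
      ((if a = b then p else 0) - pconst (f b) * pcontr \<delta> a p))"
    by (simp add: radial_def sum_distrib_right pcontr_sum pcontr_pvar_mult mult.assoc pcontr_pconst_mult)
  also have "\<dots> = (\<Sum>b\<in>UNIV. if a = b then pvar (Zv k b) * p else 0) - radial f k * pcontr \<delta> a p"
    unfolding radial_def sum_distrib_right sum_subtractf [symmetric]
    by (intro sum.cong refl) (simp add: right_diff_distrib mult.assoc)
  finally show ?thesis
    by simp
qed

text \<open>Each radial factor passed by the contraction costs a sign, and \<open>B\<close> is
  annihilated at the end. Distinctness ensures that \<open>remove1 (xs ! t)\<close> deletes position
  \<open>t\<close> and not an earlier equal entry.\<close>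

lemma pcontr_radial_list:
  assumes "distinct xs" "pcontr \<delta> a B = 0"
  shows "pcontr \<delta> a (prod_list (map (radial f) xs) * B) =
    (\<Sum>t<length xs. (-1) ^ t * (pvar (Zv (xs ! t) a) *
      (prod_list (map (radial f) (remove1 (xs ! t) xs)) * B)))"
  using assms
proof (induction xs)
  case Nil
  then show ?case by simp
next
  case (Cons x xs)
  let ?w = "\<lambda>xs. prod_list (map (radial f) xs) * B"
  have ne: "xs ! t \<noteq> x" "x \<noteq> xs ! t" if "t < length xs" for t
    using Cons.prems that by auto
  have comm: "radial f x * ((-1) ^ t * q) = (-1) ^ t * (radial f x * q)" for t q
    by (cases "even t") auto
  have comm': "radial f x * (pvar v * q) = pvar v * (radial f x * q)" for v q
    by (simp only: mult.assoc [symmetric] pvar_commute [of "radial f x"])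
  have "pcontr \<delta> a (?w (x # xs)) = pvar (Zv x a) * ?w xs - radial f x * pcontr \<delta> a (?w xs)"
    by (simp add: mult.assoc pcontr_radial_mult)
  also have "radial f x * pcontr \<delta> a (?w xs) = (\<Sum>t<length xs. (-1) ^ t * (pvar (Zv (xs ! t) a) *
      (radial f x * ?w (remove1 (xs ! t) xs))))"
    using Cons by (simp add: sum_distrib_left comm comm')
  \<comment> \<open>The head is position 0; the positions in \<open>xs\<close> move up by one, which
    absorbs the minus sign into \<open>(-1) ^ t\<close>.\<close>
  also have "pvar (Zv x a) * ?w xs - \<dots> = (\<Sum>t<length (x # xs). (-1) ^ t *
      (pvar (Zv ((x # xs) ! t) a) * ?w (remove1 ((x # xs) ! t) (x # xs))))"
    unfolding length_Cons sum.lessThan_Suc_shift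
    by (simp add: ne mult.assoc flip: sum_negf)
  finally show ?case .
qed

text \<open>The signed deletions are regrouped by label: the Kronecker delta in
  \<open>c_plus_word\<close> picks the one label held by each position.\<close>

lemma pcontr_ordered_word:
  fixes B :: "('n::{finite, linorder}, 'm, 'g) cpoly"
  assumes "B \<in> B_plus \<delta>"
  shows "pcontr \<delta> a (ordered_word (radial f) I * B) = zcol_sum (\<lambda>l. c_plus_word f l I B) a"
proof -
  let ?xs = "sorted_list_of_set I"
  let ?w = "\<lambda>t. ordered_word (radial f) (I - {?xs ! t}) * B"
  have *: "pvar v * ((-1) ^ t * q) = (-1) ^ t * (pvar v * q)"
    for v t and q :: "('n, 'm, 'g) cpoly"
    by (cases "even t") auto
  have "zcol_sum (\<lambda>l. c_plus_word f l I B) a =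
      (\<Sum>l\<in>UNIV. \<Sum>t<card I. if l = ?xs ! t then (-1) ^ t * (pvar (Zv l a) * ?w t) else 0)"
    unfolding zcol_sum_def c_plus_word_def sum_distrib_left
    by (intro sum.cong refl) (auto simp: * mult.assoc)
  also have "\<dots> = (\<Sum>t<card I. (-1) ^ t * (pvar (Zv (?xs ! t) a) * ?w t))"
    by (subst sum.swap) simp
  also have "\<dots> = pcontr \<delta> a (ordered_word (radial f) I * B)"
    using assms by (simp add: pcontr_radial_list ordered_word_def B_plus_def sorted_list_of_set_remove)
  finally show ?thesis ..
qed

text \<open>Contraction commutes with differentiation, so it may act first; the remaining
  derivatives form the left factor of \<open>Cz\<close>.\<close>

lemma s_op_ordered_word:
  assumes "B \<in> B_plus \<delta>"
  shows "s_op \<delta> i (ordered_word (radial f) I * B) = Cz (\<lambda>l. c_plus_word f l I B) i"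
  by (simp add: s_op_def Cz_eq_pdiff_zcol_sum pcontr_pdiff pcontr_ordered_word [OF assms])

lemma s_op_sum: "s_op \<delta> i (\<Sum>j\<in>S. h j) = (\<Sum>j\<in>S. s_op \<delta> i (h j))"
  unfolding s_op_def pdiff_sum pcontr_sum by (rule sum.swap)

end

section \<open>Extension from words to the radial module by additivity\<close>

lemma zcol_sum_sum: "zcol_sum (\<lambda>l. \<Sum>j\<in>S. h j l) a = (\<Sum>j\<in>S. zcol_sum (h j) a)"
  unfolding zcol_sum_def sum_distrib_left by (rule sum.swap)

lemma Cz_sum: "Cz (\<lambda>l. \<Sum>j\<in>S. h j l) i = (\<Sum>j\<in>S. Cz (h j) i)"
  unfolding Cz_eq_pdiff_zcol_sum zcol_sum_sum pdiff_sum by (rule sum.swap)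

lemma s_op_pbw_plus:
  fixes \<phi> :: "'n::{finite, linorder} set \<Rightarrow> ('n, 'm::finite, 'g::{finite, linorder}) cpoly"
  assumes "witt_basis f fd" "\<And>a. is_contraction f fd a (\<delta> a)" "\<And>I. \<phi> I \<in> B_plus \<delta>"
  shows "s_op \<delta> i (pbw_plus f \<phi>) = Cz (\<lambda>l. c_plus f l \<phi>) i"
  unfolding pbw_plus_def c_plus_def Cz_sum using assms by (simp add: s_op_sum s_op_ordered_word)

section \<open>Injectivity of \<open>Cz\<close>\<close>

definition mon_fact :: "('v \<Rightarrow>\<^sub>0 nat) \<Rightarrow> real" where
  "mon_fact t = (\<Prod>v\<in>Poly_Mapping.keys t. fact (Poly_Mapping.lookup t v))"

lemma mon_fact_pos: "mon_fact t > 0"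
  by (auto simp: mon_fact_def intro!: prod_pos)

text \<open>The ratio of the two weights is the factor produced by differentiation, which is what
  makes the derivative adjoint to the variable.\<close>

lemma mon_fact_add_single:
  "mon_fact (t + Poly_Mapping.single v 1) = real (Poly_Mapping.lookup t v + 1) * mon_fact t"
proof -
  let ?S = "insert v (Poly_Mapping.keys t)"
  \<comment> \<open>Both products are taken over one index set; the added factors are
    \<open>fact 0 = 1\<close>.\<close>
  have 1: "mon_fact s = (\<Prod>w\<in>?S. fact (Poly_Mapping.lookup s w))"
    if "Poly_Mapping.keys s \<subseteq> ?S" for s
    unfolding mon_fact_def using that by (intro prod.mono_neutral_left) (auto simp: in_keys_iff)
  have 2: "Poly_Mapping.keys (t + Poly_Mapping.single v 1) \<subseteq> ?S"
    by (auto simp: in_keys_iff lookup_add lookup_single when_def split: if_splits)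
  show ?thesis
    unfolding 1 [OF 2] 1 [OF subset_insertI]
    by (auto simp: prod.insert_remove lookup_add lookup_single when_def intro!: prod.cong split: if_splits)
qed

text \<open>Real part of the Hermitian form for which the ordered products of generators are
  orthonormal.\<close>

definition coeff_inner :: "'g::finite clifford \<Rightarrow> 'g clifford \<Rightarrow> real" where
  "coeff_inner x y = (\<Sum>A\<in>UNIV. Re (cnj (coeff x A) * coeff y A))"

lemma coeff_inner_simps:
  fixes x y :: "'g::{finite, linorder} clifford"
  shows "coeff_inner (x + y) z = coeff_inner x z + coeff_inner y z"
    "coeff_inner z (x + y) = coeff_inner z x + coeff_inner z y"
    "coeff_inner 0 z = 0" "coeff_inner z 0 = 0"
  by (simp_all add: coeff_inner_def algebra_simps sum.distrib)

lemma coeff_inner_of_nat_mult: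
  fixes x y :: "'g::{finite, linorder} clifford"
  shows "coeff_inner x (of_nat k * y) = of_nat k * coeff_inner x y"
  by (induction k) (simp_all add: coeff_inner_simps distrib_right)

lemma coeff_inner_self: "coeff_inner x x = (\<Sum>A\<in>UNIV. (cmod (coeff x A))\<^sup>2)"
  by (simp add: coeff_inner_def cmod_def power2_eq_square)

lemma coeff_inner_eq_0D:
  fixes x :: "'g::{finite, linorder} clifford"
  assumes "coeff_inner x x = 0"
  shows "x = 0"
  using assms by (intro clifford_eqI) (simp add: coeff_inner_self sum_nonneg_eq_0_iff)

text \<open>The real part of the Fischer inner product.\<close>

definition fischer ::
  "('n, 'm, 'g::{finite, linorder}) cpoly \<Rightarrow> ('n, 'm, 'g) cpoly \<Rightarrow> real" where
  "fischer p q = (\<Sum>t\<in>Poly_Mapping.keys p.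
     mon_fact t * coeff_inner (Poly_Mapping.lookup p t) (Poly_Mapping.lookup q t))"

lemma fischer_superset:
  assumes "finite S" "Poly_Mapping.keys p \<subseteq> S"
  shows "fischer p q = (\<Sum>t\<in>S. mon_fact t * coeff_inner (Poly_Mapping.lookup p t) (Poly_Mapping.lookup q t))"
  unfolding fischer_def using assms
  by (intro sum.mono_neutral_left) (auto simp: in_keys_iff coeff_inner_simps)

lemma fischer_add_left: "fischer (p + q) r = fischer p r + fischer q r"
proof -
  let ?S = "Poly_Mapping.keys p \<union> Poly_Mapping.keys q"
  have "Poly_Mapping.keys (p + q) \<subseteq> ?S"
    by (rule keys_add)
  then show ?thesis
    by (simp add: fischer_superset [of ?S] lookup_add coeff_inner_simps distrib_left sum.distrib)
qed

lemma fischer_0_left: "fischer 0 r = 0"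
  by (simp add: fischer_def)

lemma fischer_sum_left: "fischer (\<Sum>i\<in>S. h i) r = (\<Sum>i\<in>S. fischer (h i) r)"
  by (induction S rule: infinite_finite_induct) (auto simp: fischer_add_left fischer_0_left)

lemma fischer_add_right: "fischer p (q + r) = fischer p q + fischer p r"
  by (simp add: fischer_def lookup_add coeff_inner_simps distrib_left sum.distrib)

lemma fischer_0_right: "fischer p 0 = 0"
  by (simp add: fischer_def coeff_inner_simps)

lemma fischer_sum_right: "fischer p (\<Sum>i\<in>S. h i) = (\<Sum>i\<in>S. fischer p (h i))"
  by (induction S rule: infinite_finite_induct) (auto simp: fischer_add_right fischer_0_right)

lemma fischer_self_nonneg: "fischer p p \<ge> 0"
  unfolding fischer_def
  by (intro sum_nonneg mult_nonneg_nonneg) (auto simp: mon_fact_pos less_imp_le coeff_inner_self sum_nonneg)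

lemma fischer_eq_0D:
  assumes "fischer p p = 0"
  shows "p = 0"
proof (rule poly_mapping_eqI)
  fix t
  have nonneg: "coeff_inner x x \<ge> 0" for x :: "'c clifford"
    by (simp add: coeff_inner_self sum_nonneg)
  have "\<forall>t\<in>Poly_Mapping.keys p.
      mon_fact t * coeff_inner (Poly_Mapping.lookup p t) (Poly_Mapping.lookup p t) = 0"
    using assms unfolding fischer_def
    by (subst (asm) sum_nonneg_eq_0_iff) (auto intro: mult_nonneg_nonneg [OF less_imp_le [OF mon_fact_pos] nonneg])
  then show "Poly_Mapping.lookup p t = Poly_Mapping.lookup 0 t"
    using mon_fact_pos [of t] coeff_inner_eq_0D
    by (cases "t \<in> Poly_Mapping.keys p") (fastforce simp: in_keys_iff)+
qed

text \<open>Multiplication by \<open>v\<close> shifts the support of \<open>p\<close>; after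
  reindexing, the ratio of the weights turns into the factor in \<open>pdiff\<close>.\<close>

lemma fischer_pvar_mult: "fischer (pvar v * p) q = fischer p (pdiff v q)"
proof -
  let ?s = "\<lambda>t. t + Poly_Mapping.single v (1::nat)"
  have sub: "Poly_Mapping.keys (pvar v * p) \<subseteq> ?s ` Poly_Mapping.keys p"
  proof
    fix t
    assume "t \<in> Poly_Mapping.keys (pvar v * p)"
    then have "Poly_Mapping.lookup t v \<noteq> 0" "t - Poly_Mapping.single v 1 \<in> Poly_Mapping.keys p"
      by (auto simp: in_keys_iff lookup_pvar_mult split: if_splits)
    moreover from this(1) have "t = ?s (t - Poly_Mapping.single v 1)"
      by (auto simp: poly_mapping_eq_iff fun_eq_iff lookup_add lookup_minus lookup_single when_def)
    ultimately show "t \<in> ?s ` Poly_Mapping.keys p"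
      by blast
  qed
  have "fischer (pvar v * p) q = (\<Sum>t\<in>?s ` Poly_Mapping.keys p. mon_fact t *
      coeff_inner (Poly_Mapping.lookup (pvar v * p) t) (Poly_Mapping.lookup q t))"
    using sub by (intro fischer_superset) auto
  also have "\<dots> = (\<Sum>t\<in>Poly_Mapping.keys p. mon_fact (?s t) *
      coeff_inner (Poly_Mapping.lookup p t) (Poly_Mapping.lookup q (?s t)))"
    by (subst sum.reindex) (simp_all add: inj_on_def lookup_pvar_mult_add del: One_nat_def)
  also have "\<dots> = fischer p (pdiff v q)"
    unfolding fischer_def lookup_pdiff coeff_inner_of_nat_mult mon_fact_add_single
    by (simp add: mult_ac)
  finally show ?thesis .
qed

section \<open>Kernel of \<open>Cz\<close>\<close>

lemma zcol_sum_eq_0_if_Cz_eq_0: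
  assumes "Cz p = (\<lambda>_. 0)"
  shows "zcol_sum p a = 0"
proof -
  \<comment> \<open>As in the proof that an operator \<open>A\<close> and its product with its
    adjoint, \<open>A* A\<close>, have the same kernel: the left argument is expanded and its
    variables move to the right as derivatives.\<close>
  have "(\<Sum>a\<in>UNIV. fischer (zcol_sum p a) (zcol_sum p a)) =
      (\<Sum>a\<in>UNIV. \<Sum>l\<in>UNIV. fischer (p l) (pdiff (Zv l a) (zcol_sum p a)))"
    by (subst (1) zcol_sum_def) (simp add: fischer_sum_left fischer_pvar_mult)
  also have "\<dots> = (\<Sum>l\<in>UNIV. fischer (p l) (Cz p l))"
    unfolding Cz_eq_pdiff_zcol_sum fischer_sum_right by (rule sum.swap)
  also have "\<dots> = 0"
    using assms by (simp add: fischer_0_right)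
  finally show ?thesis
    by (intro fischer_eq_0D) (simp add: sum_nonneg_eq_0_iff fischer_self_nonneg)
qed

text \<open>A monomial of largest possible degree in the diagonal variables \<open>z\<^sub>k\<^sub>\<sigma>\<^sub>(\<^sub>k\<^sub>)\<close> among
  all entries \<open>p l\<close> cannot cancel: the off-diagonal products do not reach the degree of its diagonal product.\<close>

lemma zcol_sum_eq_0D:
  fixes p :: "'n::finite \<Rightarrow> ('n, 'm::finite, 'g::{finite, linorder}) cpoly"
  assumes card: "CARD('n) \<le> CARD('m)" and 0: "\<And>a. zcol_sum p a = 0"
  shows "p k = 0"
proof (rule ccontr)
  assume "p k \<noteq> 0"
  \<comment> \<open>There are enough columns to give each label \<open>k\<close> its own column
    \<open>\<sigma> k\<close>, hence its own diagonal variable.\<close>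
  obtain \<sigma> :: "'n \<Rightarrow> 'm" where \<sigma>: "inj \<sigma>"
    using card card_le_inj [of "UNIV :: 'n set" "UNIV :: 'm set"] by auto
  define d where "d t = (\<Sum>k\<in>UNIV. Poly_Mapping.lookup t (Zv k (\<sigma> k)))" for t :: "('n, 'm) var \<Rightarrow>\<^sub>0 nat"
  define S where "S = Sigma UNIV (\<lambda>k. Poly_Mapping.keys (p k))"
  have "finite S" "S \<noteq> {}"
    using \<open>p k \<noteq> 0\<close> by (auto simp: S_def Sigma_empty_iff)
  then have "Max ((\<lambda>y. d (snd y)) ` S) \<in> (\<lambda>y. d (snd y)) ` S"
    by (intro Max_in) auto
  then obtain x where x: "x \<in> S" "d (snd x) = Max ((\<lambda>y. d (snd y)) ` S)"
    by auto
  have le: "d (snd y) \<le> d (snd x)" if "y \<in> S" for y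
    using that \<open>finite S\<close> by (simp add: x(2))
  obtain j t where jt: "x = (j, t)"
    by (cases x)
  have t: "Poly_Mapping.lookup (p j) t \<noteq> 0"
    using x(1) by (simp add: S_def jt in_keys_iff)
  have max: "Poly_Mapping.lookup (p l) s = 0" if "d s > d t" for l s
    using le [of "(l, s)"] that by (auto simp: S_def jt in_keys_iff)
  let ?u = "t + Poly_Mapping.single (Zv j (\<sigma> j)) 1"
  \<comment> \<open>Reduces the indicator in \<open>d ?u\<close> to a single label, so the added
    variable counts exactly once.\<close>
  have "j = k \<and> \<sigma> j = \<sigma> k \<longleftrightarrow> j = k" for k
    by auto
  then have du: "d ?u = d t + 1"
    by (simp add: d_def lookup_add lookup_single when_def sum.distrib)
  have off: "Poly_Mapping.lookup (pvar (Zv l (\<sigma> j)) * p l) ?u = 0" if "l \<noteq> j" for l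
  proof -
    \<comment> \<open>For \<open>l \<noteq> j\<close> injectivity of \<open>\<sigma>\<close> makes
      this variable off-diagonal, so dividing by it keeps the diagonal degree at
      \<open>d t + 1\<close>, above the maximum.\<close>
    have "d (?u - Poly_Mapping.single (Zv l (\<sigma> j)) 1) = d ?u"
      unfolding d_def using that \<sigma>
      by (intro sum.cong refl) (auto simp: lookup_minus lookup_single when_def dest: injD)
    then show ?thesis
      using du by (auto simp: lookup_pvar_mult intro!: max)
  qed
  have "0 = Poly_Mapping.lookup (zcol_sum p (\<sigma> j)) ?u"
    using 0 by simp
  also have "\<dots> = (\<Sum>l\<in>UNIV. if l = j then Poly_Mapping.lookup (pvar (Zv l (\<sigma> j)) * p l) ?u else 0)"
    unfolding zcol_sum_def lookup_sum using off by (intro sum.cong) auto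
  also have "\<dots> = Poly_Mapping.lookup (p j) t"
    using lookup_pvar_mult_add [of "Zv j (\<sigma> j)" "p j" t] by simp
  finally show False
    using t by simp
qed

text \<open>\<open>Cz\<close> respects differences, so it suffices that its kernel vanishes.\<close>

lemma inj_Cz:
  assumes "CARD('n::finite) \<le> CARD('m::finite)"
  shows "inj (Cz :: ('n \<Rightarrow> ('n, 'm, 'g::{finite, linorder}) cpoly) \<Rightarrow> _)"
proof (rule injI)
  fix p q :: "'n \<Rightarrow> ('n, 'm, 'g) cpoly"
  assume eq: "Cz p = Cz q"
  have z: "zcol_sum (\<lambda>l. p l - q l) a = zcol_sum p a - zcol_sum q a" for a
    by (simp add: zcol_sum_def right_diff_distrib sum_subtractf)
  have "Cz (\<lambda>l. p l - q l) i = Cz p i - Cz q i" for i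
    by (simp add: Cz_eq_pdiff_zcol_sum z pdiff_diff sum_subtractf)
  then have "Cz (\<lambda>l. p l - q l) = (\<lambda>_. 0)"
    using eq by auto
  then have "p k - q k = 0" for k
    using zcol_sum_eq_0D [OF assms, of "\<lambda>l. p l - q l"] zcol_sum_eq_0_if_Cz_eq_0 by blast
  then show "p = q"
    by (intro ext) simp
qed

text \<open>The label contractions form a preimage of the column of the \<open>s_op\<close>, and by
  injectivity \<open>inv Cz\<close> returns exactly this preimage.\<close>

lemma n_plus_ordered_word:
  fixes B :: "('n::{finite, linorder}, 'm::finite, 'g::{finite, linorder}) cpoly"
  assumes "witt_basis f fd" "\<And>a. is_contraction f fd a (\<delta> a)" "B \<in> B_plus \<delta>"
    and "CARD('n) \<le> CARD('m)"
  shows "n_plus \<delta> i (ordered_word (radial f) I * B) = c_plus_word f i I B"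
proof -
  have "(\<lambda>l. s_op \<delta> l (ordered_word (radial f) I * B)) = Cz (\<lambda>l. c_plus_word f l I B)"
    using s_op_ordered_word [OF assms(1-3)] by blast
  then show ?thesis
    by (simp add: n_plus_def inv_f_f [OF inj_Cz [OF assms(4)]])
qed

section \<open>Conjugation\<close>

context
  fixes f fd :: "'m::finite \<Rightarrow> 'g::{finite, linorder} clifford"
    and \<kappa> :: "('n::{finite, linorder}, 'm, 'g) cpoly \<Rightarrow> ('n, 'm, 'g) cpoly"
  assumes herm: "is_herm_conj f fd \<kappa>"
begin

lemma herm_conj_simps:
  "\<kappa> (x + y) = \<kappa> x + \<kappa> y" "\<kappa> (x * y) = \<kappa> x * \<kappa> y" "\<kappa> (\<kappa> x) = x"
  "\<kappa> (pvar (Zbv k a)) = pvar (Zv k a)" "\<kappa> (pconst (fd a)) = pconst (f a)"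
  using herm by (auto simp: is_herm_conj_def)

lemma herm_conj_0: "\<kappa> 0 = 0"
  using herm_conj_simps(1) [of 0 0] by simp

text \<open>Unitality follows by applying multiplicativity and involutivity to
  \<open>1 * \<kappa> 1\<close>.\<close>

lemma herm_conj_1: "\<kappa> 1 = 1"
  using herm_conj_simps(2) [of 1 "\<kappa> 1"] by (simp add: herm_conj_simps(3))

lemma herm_conj_of_nat: "\<kappa> (of_nat k) = of_nat k"
  by (induction k) (simp_all add: herm_conj_0 herm_conj_1 herm_conj_simps)

lemma herm_conj_sum: "\<kappa> (\<Sum>i\<in>S. h i) = (\<Sum>i\<in>S. \<kappa> (h i))"
  by (induction S rule: infinite_finite_induct) (auto simp: herm_conj_0 herm_conj_simps)

lemma herm_conj_radial_dag: "\<kappa> (radial_dag fd k) = radial f k"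
  by (simp add: radial_dag_def radial_def herm_conj_sum herm_conj_simps)

text \<open>The conjugation does not reverse products, so the order of the labels survives and no
  sign appears.\<close>

lemma herm_conj_ordered_word: "\<kappa> (ordered_word (radial_dag fd) I) = ordered_word (radial f) I"
proof -
  have "\<kappa> (prod_list (map (radial_dag fd) xs)) = prod_list (map (radial f) xs)" for xs
    by (induction xs) (simp_all add: herm_conj_1 herm_conj_simps herm_conj_radial_dag)
  then show ?thesis
    by (simp add: ordered_word_def)
qed

lemma herm_conj_pbw_minus: "\<kappa> (pbw_minus fd \<phi>) = pbw_plus f (\<lambda>I. \<kappa> (\<phi> I))"
  by (simp add: pbw_minus_def pbw_plus_def herm_conj_sum herm_conj_simps herm_conj_ordered_word)

lemma herm_conj_c_minus: "\<kappa> (c_minus f \<kappa> i \<phi>) = c_plus f i (\<lambda>I. \<kappa> (\<phi> I))"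
  by (simp add: c_minus_def c_plus_def c_minus_word_def conj_op_def herm_conj_sum herm_conj_simps)

lemma herm_conj_B_minus: "B \<in> B_minus \<delta> \<kappa> \<Longrightarrow> \<kappa> B \<in> B_plus \<delta>"
  by (auto simp: B_minus_def herm_conj_simps)

text \<open>The scalar \<open>CARD('m)\<close> is fixed by conjugation, so only the Euler operators
  are replaced by their conjugates.\<close>

lemma herm_conj_Cz:
  "\<kappa> (Cz (\<lambda>l. \<kappa> (p l)) i) =
    (\<Sum>l\<in>UNIV. (if i = l then of_nat CARD('m) * p l else 0) + conj_op \<kappa> (Ez l i) (p l))"
  unfolding Cz_def Cz_entry_def herm_conj_sum
  by (intro sum.cong refl) (simp add: conj_op_def herm_conj_0 herm_conj_simps herm_conj_of_nat)

end

section \<open>The plus identities and their conjugates\<close>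

theorem theorem4p2:
  fixes f fd :: "'m::finite \<Rightarrow> 'g::{finite, linorder} clifford"
    and \<delta> :: "'m \<Rightarrow> 'g clifford \<Rightarrow> 'g clifford"
    and \<kappa> :: "('n::{finite, linorder}, 'm, 'g) cpoly \<Rightarrow> ('n, 'm, 'g) cpoly"
  assumes "witt_basis f fd"
    and "\<And>a. is_contraction f fd a (\<delta> a)"
    and "is_herm_conj f fd \<kappa>"
  shows "(\<forall>\<phi> :: 'n set \<Rightarrow> ('n, 'm, 'g) cpoly. (\<forall>I. \<phi> I \<in> B_plus \<delta>) \<longrightarrow>
            (\<forall>i. s_op \<delta> i (pbw_plus f \<phi>) =
              (\<Sum>l\<in>UNIV. (if i = l then of_nat CARD('m) * c_plus f l \<phi> else 0)
                        + Ez l i (c_plus f l \<phi>))))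
       \<and> (CARD('m) \<ge> 2 * CARD('n) \<longrightarrow>
            (\<forall>i I. \<forall>B \<in> (B_plus \<delta> :: ('n, 'm, 'g) cpoly set).
              n_plus \<delta> i (ordered_word (radial f) I * B) = c_plus_word f i I B))
       \<and> (\<forall>\<phi> :: 'n set \<Rightarrow> ('n, 'm, 'g) cpoly. (\<forall>I. \<phi> I \<in> B_minus \<delta> \<kappa>) \<longrightarrow>
            (\<forall>i. conj_op \<kappa> (s_op \<delta> i) (pbw_minus fd \<phi>) =
              (\<Sum>l\<in>UNIV. (if i = l then of_nat CARD('m) * c_minus f \<kappa> l \<phi> else 0)
                        + conj_op \<kappa> (Ez l i) (c_minus f \<kappa> l \<phi>))))
       \<and> (CARD('m) \<ge> 2 * CARD('n) \<longrightarrow>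
            (\<forall>i I. \<forall>B \<in> B_minus \<delta> \<kappa>.
              n_minus \<delta> \<kappa> i (ordered_word (radial_dag fd) I * B) = c_minus_word f \<kappa> i I B))"
proof (intro conjI impI allI ballI)
  note c = assms(1,2) and \<kappa> = assms(3)
  show "s_op \<delta> i (pbw_plus f \<phi>) =
      (\<Sum>l\<in>UNIV. (if i = l then of_nat CARD('m) * c_plus f l \<phi> else 0) + Ez l i (c_plus f l \<phi>))"
    if "\<forall>I. \<phi> I \<in> B_plus \<delta>" for \<phi> :: "'n set \<Rightarrow> ('n, 'm, 'g) cpoly" and i
    using s_op_pbw_plus [OF c, of \<phi>] that by (simp add: Cz_def Cz_entry_def)
  show "n_plus \<delta> i (ordered_word (radial f) I * B) = c_plus_word f i I B"
    if "2 * CARD('n) \<le> CARD('m)" "B \<in> B_plus \<delta>" for i I and B :: "('n, 'm, 'g) cpoly"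
    using n_plus_ordered_word [OF c that(2)] that(1) by simp
  show "conj_op \<kappa> (s_op \<delta> i) (pbw_minus fd \<phi>) =
      (\<Sum>l\<in>UNIV. (if i = l then of_nat CARD('m) * c_minus f \<kappa> l \<phi> else 0)
        + conj_op \<kappa> (Ez l i) (c_minus f \<kappa> l \<phi>))"
    if "\<forall>I. \<phi> I \<in> B_minus \<delta> \<kappa>" for \<phi> i
  proof -
    \<comment> \<open>The plus identity is applied to the conjugated family, whose members lie in
      \<open>B_plus \<delta>\<close>; conjugating back gives the claim.\<close>
    have "s_op \<delta> i (pbw_plus f (\<lambda>I. \<kappa> (\<phi> I))) = Cz (\<lambda>l. \<kappa> (c_minus f \<kappa> l \<phi>)) i"
      using s_op_pbw_plus [OF c, of "\<lambda>I. \<kappa> (\<phi> I)"] that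
      by (simp add: herm_conj_B_minus [OF \<kappa>] herm_conj_c_minus [OF \<kappa>])
    then show ?thesis
      by (simp add: conj_op_def [of _ "s_op \<delta> i"] herm_conj_pbw_minus [OF \<kappa>] herm_conj_Cz [OF \<kappa>])
  qed
  \<comment> \<open>The inner conjugation in \<open>n_minus\<close> turns the minus word into the
    plus word with coefficient \<open>\<kappa> B\<close>.\<close>
  show "n_minus \<delta> \<kappa> i (ordered_word (radial_dag fd) I * B) = c_minus_word f \<kappa> i I B"
    if "2 * CARD('n) \<le> CARD('m)" "B \<in> B_minus \<delta> \<kappa>" for i I B
    using n_plus_ordered_word [OF c herm_conj_B_minus [OF \<kappa> that(2)]] that(1)
    by (simp add: n_minus_def c_minus_word_def conj_op_def herm_conj_simps [OF \<kappa>]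
        herm_conj_ordered_word [OF \<kappa>])
qed

end
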